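(* Let $H$ be a finite Boolean algebra and let $M$ be a Heyting module over $H$. Then the duality between $M$ and $M^{\bigstar}$ is separating, i.e. if $m_1,m_2\in M$ are such that $\phi(m_1)=\phi(m_2)$ for every $\phi\in M^{\bigstar}$, then $m_1=m_2$.
   Context: Lattices have all finite meets and joins (hence a least element $0$ and a greatest element $1$). A join semilattice is a poset in which every finite subset, including the empty one, has a join; its least element is $0$. For a distributive lattice $L$, a distributive module over $L$ is a join semilattice $M$ with an action $L\times M\to M$, $(x,m)\mapsto x\wedge m$, order preserving in both variables, such that $1\wedge m=m$, $0\wedge m=0$, $(x\wedge y)\wedge m=x\wedge(y\wedge m)$, $(x\vee y)\wedge m=(x\wedge m)\vee(y\wedge m)$, $x\wedge(m\vee n)=(x\wedge m)\vee(x\wedge n)$. Morphisms are maps preserving finite joins (including $0$) and satisfying $g(x\wedge m)=x\wedge g(m)$. A Heyting algebra $H$ is a lattice such that for all $y,z\in H$ there is $(y\to z)_H\in H$ with $x\wedge y\le z\Leftrightarrow x\le (y\to z)_H$ for all $x\in H$ (every Boolean algebra is one). A Heyting module over $H$ is a distributive module $M$ over $H$ such that for all $m,n\in M$ there is $(m\to n)_M\in H$ with $x\wedge m\le n\Leftrightarrow x\le(m\to n)_M$ for all $x\in H$; morphisms are morphisms of distributive modules. $H$ is a Heyting module over itself and $M^{\bigstar}$ denotes the set of morphisms of Heyting modules $M\to H$. *)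

theory Defs
  imports Main
begin

(* The implication is only required to exist, as a property of the lattice; it is not part of
   the signature. *)
class heyting_algebra = bounded_lattice +
  assumes ex_implication: "\<exists>h. \<forall>x. inf x y \<le> z \<longleftrightarrow> x \<le> h"

subclass (in heyting_algebra) distrib_lattice
proof
  fix x y z :: 'a
  show "sup x (inf y z) = inf (sup x y) (sup x z)"
  proof (rule order.antisym)
    show "sup x (inf y z) \<le> inf (sup x y) (sup x z)"
      by (simp add: le_infI1 le_infI2)
  next
    let ?r = "sup x (inf y z)"
    have distrib: "inf (sup a b) c \<le> d" if "inf a c \<le> d" "inf b c \<le> d" for a b c d
    proof -
      obtain h where h: "\<And>x. inf x c \<le> d \<longleftrightarrow> x \<le> h" using ex_implication by blast
      show ?thesis using that unfolding h by (rule sup_least)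
    qed
    have "inf y (sup x z) \<le> ?r"
    proof -
      have "inf (sup x z) y \<le> ?r"
        by (rule distrib) (simp_all add: le_infI1 inf_commute le_supI2)
      then show ?thesis by (simp add: inf_commute)
    qed
    moreover have "inf x (sup x z) \<le> ?r"
      by (simp add: le_infI1)
    ultimately show "inf (sup x y) (sup x z) \<le> ?r"
      by (intro distrib)
  qed
qed

subclass (in boolean_algebra) heyting_algebra
proof
  fix y z :: 'a
  show "\<exists>h. \<forall>x. inf x y \<le> z \<longleftrightarrow> x \<le> h"
    by (intro exI[of _ "sup (- y) z"]) (simp add: shunt1)
qed

locale distributive_module =
  fixes act :: "'h::{distrib_lattice,bounded_lattice} \<Rightarrow> 'm::bounded_semilattice_sup_bot \<Rightarrow> 'm"
  assumes act_mono: "x \<le> y \<Longrightarrow> m \<le> n \<Longrightarrow> act x m \<le> act y n"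
    and act_top: "act top m = m"
    and act_bot: "act bot m = bot"
    and act_inf: "act (inf x y) m = act x (act y m)"
    and act_sup_left: "act (sup x y) m = sup (act x m) (act y m)"
    and act_sup_right: "act x (sup m n) = sup (act x m) (act x n)"

locale heyting_module = distributive_module act
  for act :: "'h::heyting_algebra \<Rightarrow> 'm::bounded_semilattice_sup_bot \<Rightarrow> 'm" +
  assumes ex_implication_act: "\<exists>h. \<forall>x. act x m \<le> n \<longleftrightarrow> x \<le> h"

locale distributive_module_morphism =
  source: distributive_module act\<^sub>M + target: distributive_module act\<^sub>N
  for act\<^sub>M :: "'h::{distrib_lattice,bounded_lattice} \<Rightarrow> 'm::bounded_semilattice_sup_bot \<Rightarrow> 'm"
    and act\<^sub>N :: "'h \<Rightarrow> 'n::bounded_semilattice_sup_bot \<Rightarrow> 'n" +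
  fixes g :: "'m \<Rightarrow> 'n"
  assumes map_bot: "g bot = bot"
    and map_sup: "g (sup m n) = sup (g m) (g n)"
    and map_act: "g (act\<^sub>M x m) = act\<^sub>N x (g m)"

locale heyting_module_morphism =
  source: heyting_module act\<^sub>M + target: heyting_module act\<^sub>N +
  distributive_module_morphism act\<^sub>M act\<^sub>N g
  for act\<^sub>M :: "'h::heyting_algebra \<Rightarrow> 'm::bounded_semilattice_sup_bot \<Rightarrow> 'm"
    and act\<^sub>N :: "'h \<Rightarrow> 'n::bounded_semilattice_sup_bot \<Rightarrow> 'n"
    and g :: "'m \<Rightarrow> 'n"

lemma heyting_module_inf:
  "heyting_module (inf :: 'h::heyting_algebra \<Rightarrow> 'h \<Rightarrow> 'h)"
proof
  fix x y m n :: 'h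
  show "inf x m \<le> inf y n" if "x \<le> y" "m \<le> n"
    using that by (rule inf_mono)
  show "inf top m = m" "inf bot m = bot"
    by simp_all
  show "inf (inf x y) m = inf x (inf y m)"
    by (rule inf_assoc)
  show "inf (sup x y) m = sup (inf x m) (inf y m)"
    by (rule inf_sup_distrib2)
  show "inf x (sup m n) = sup (inf x m) (inf x n)"
    by (rule inf_sup_distrib1)
  show "\<exists>h. \<forall>x. inf x m \<le> n \<longleftrightarrow> x \<le> h"
    by (rule ex_implication)
qed

definition heyting_dual ::
    "('h::heyting_algebra \<Rightarrow> 'm::bounded_semilattice_sup_bot \<Rightarrow> 'm) \<Rightarrow> ('m \<Rightarrow> 'h) set"
  where "heyting_dual act = {\<phi>. heyting_module_morphism act inf \<phi>}"

end

theory Submission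
  imports Defs
begin

text \<open>For an atom \<open>a\<close> of \<open>H\<close> and \<open>n \<in> M\<close>, the map sending \<open>m\<close> to \<open>0\<close> if \<open>a \<and> m \<le> n\<close>, and to \<open>a\<close>
  otherwise, is a morphism \<open>M \<rightarrow> H\<close>. Taking \<open>n = m\<^sub>2\<close>, equality of its values at \<open>m\<^sub>1\<close> and \<open>m\<^sub>2\<close>
  gives \<open>a \<le> (m\<^sub>1 \<rightarrow> m\<^sub>2)\<close>. As every nonzero element of \<open>H\<close> lies above an atom, \<open>m\<^sub>1 \<rightarrow> m\<^sub>2\<close> is
  the top element, that is, \<open>m\<^sub>1 \<le> m\<^sub>2\<close>.\<close>

context distributive_module
begin

lemma act_le: "act x m \<le> m"
  using act_mono[of x top m m] by (simp add: act_top)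

lemma act_bot_right: "act x bot = bot"
  using act_le[of x bot] by (simp add: bot_unique)

end

lemma atom_below:
  fixes x :: "'h::{finite,order_bot}"
  assumes "x \<noteq> bot"
  obtains a where "a \<le> x" "a \<noteq> bot" "\<And>b. b \<le> a \<Longrightarrow> b = bot \<or> b = a"
proof -
  obtain a where "a \<le> x" "a \<noteq> bot" "\<forall>b\<in>{y. y \<noteq> bot}. b \<le> a \<longrightarrow> a = b"
    using finite_has_minimal2[of "{y. y \<noteq> bot}" x] assms by auto
  then show thesis
    by (intro that) auto
qed

text \<open>Joins are preserved because \<open>act a\<close> preserves them and a join is below
  \<open>n\<close> iff both parts are; the action is respected because \<open>inf a x\<close> is
  \<open>bot\<close> or \<open>a\<close>.\<close>

lemma atom_indicator_in_heyting_dual: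
  fixes act :: "'h::heyting_algebra \<Rightarrow> 'm::bounded_semilattice_sup_bot \<Rightarrow> 'm"
  assumes "heyting_module act"
    and atom: "\<And>b. b \<le> a \<Longrightarrow> b = bot \<or> b = a"
  shows "(\<lambda>m. if act a m \<le> n then bot else a) \<in> heyting_dual act"
proof -
  interpret heyting_module act by fact
  interpret H: heyting_module "inf :: 'h \<Rightarrow> 'h \<Rightarrow> 'h" by (rule heyting_module_inf)
  have "heyting_module_morphism act inf (\<lambda>m. if act a m \<le> n then bot else a)"
  proof
    show "(if act a bot \<le> n then bot else a) = bot"
      by (simp add: act_bot_right)
  next
    fix p q
    show "(if act a (sup p q) \<le> n then bot else a)
      = sup (if act a p \<le> n then bot else a) (if act a q \<le> n then bot else a)"
      by (simp add: act_sup_right)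
  next
    fix x m
    consider "inf a x = bot" | "inf a x = a"
      using atom[of "inf a x"] by auto
    then show "(if act a (act x m) \<le> n then bot else a) = inf x (if act a m \<le> n then bot else a)"
      by cases (simp_all add: act_inf[symmetric] act_bot inf_commute)
  qed
  then show ?thesis
    by (simp add: heyting_dual_def)
qed

lemma le_if_heyting_dual_eq:
  fixes act :: "'h::{finite,boolean_algebra} \<Rightarrow> 'm::bounded_semilattice_sup_bot \<Rightarrow> 'm"
  assumes "heyting_module act"
    and dual: "\<And>\<phi>. \<phi> \<in> heyting_dual act \<Longrightarrow> \<phi> m = \<phi> n"
  shows "m \<le> n"
proof -
  interpret heyting_module act by fact
  obtain h where h: "\<And>x. act x m \<le> n \<longleftrightarrow> x \<le> h"
    using ex_implication_act by blast
  \<comment> \<open>An atom below \<open>- h\<close> will turn out to lie below \<open>h\<close> as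
    well, which forces it to be \<open>bot\<close>.\<close>
  have "- h = bot"
  proof (rule ccontr)
    assume "- h \<noteq> bot"
    then obtain a where a: "a \<le> - h" "a \<noteq> bot" "\<And>b. b \<le> a \<Longrightarrow> b = bot \<or> b = a"
      by (rule atom_below) blast
    \<comment> \<open>The indicator vanishes at \<open>n\<close> since
      \<open>act a n \<le> n\<close>, hence also at \<open>m\<close>; as \<open>a\<close> is not
      \<open>bot\<close>, this gives the claim.\<close>
    have "act a m \<le> n"
      using dual[OF atom_indicator_in_heyting_dual[OF assms(1) a(3), of n]] a(2) act_le[of a n]
      by (simp split: if_splits)
    then have "a \<le> inf h (- h)"
      using a(1) by (intro le_infI) (simp_all add: h)
    then show False
      using a(2) by (simp add: bot_unique)
  qed
  then have "h = top"
    using double_compl[of h] by simp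
  then show ?thesis
    using h[of top] by (simp add: act_top)
qed

theorem proposition4p9:
  fixes act :: "'h::{finite,boolean_algebra} \<Rightarrow> 'm::bounded_semilattice_sup_bot \<Rightarrow> 'm"
    and m\<^sub>1 m\<^sub>2 :: 'm
  assumes "heyting_module act"
    and "\<And>\<phi>. \<phi> \<in> heyting_dual act \<Longrightarrow> \<phi> m\<^sub>1 = \<phi> m\<^sub>2"
  shows "m\<^sub>1 = m\<^sub>2"
  using assms by (intro order.antisym le_if_heyting_dual_eq[of act]) (simp_all add: assms(2))

end
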